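(* For every Swiss cheese $\mathbf D$ with $\delta(\mathbf D)>0$, there is a classical Swiss cheese $\mathbf D'$ with $X_{\mathbf D'}\subseteq X_{\mathbf D}$ and $\delta(\mathbf D')\ge\delta(\mathbf D)$.
   Context: For an open or closed disc $D$ in $\mathbb C$, $r(D)$ denotes its radius; a disc has positive finite radius. A Swiss cheese is a pair $\mathbf D=(\Delta,\mathcal D)$ where $\Delta$ is a compact (closed) disc in $\mathbb C$ and $\mathcal D$ is a countable or finite collection (set) of open discs in $\mathbb C$ (no disjointness or containment in $\Delta$ is required). The associated Swiss cheese set is $X_{\mathbf D}:=\Delta\setminus\bigcup\mathcal D$. $\delta(\mathbf D):=r(\Delta)-\sum_{D\in\mathcal D}r(D)\in[-\infty,\infty)$. A Swiss cheese $\mathbf D=(\Delta,\mathcal D)$ is classical if the closures of the discs in $\mathcal D$ intersect neither one another (i.e. closures of distinct members of $\mathcal D$ are disjoint) nor $\mathbb C\setminus\mathrm{int}(\Delta)$, and $\sum_{D\in\mathcal D}r(D)<\infty$. *)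

theory Defs
  imports "HOL-Analysis.Analysis"
begin

definition open_disc :: "complex set \<Rightarrow> bool" where
  "open_disc D \<longleftrightarrow> (\<exists>c r. 0 < r \<and> D = ball c r)"

definition closed_disc :: "complex set \<Rightarrow> bool" where
  "closed_disc D \<longleftrightarrow> (\<exists>c r. 0 < r \<and> D = cball c r)"

(* Meaningful only for open or closed discs; well-defined there by the two lemmas below. *)
definition disc_radius :: "complex set \<Rightarrow> real" where
  "disc_radius D = (THE r. 0 < r \<and> (\<exists>c. D = ball c r \<or> D = cball c r))"

lemma disc_radius_ball:
  assumes "0 < r"
  shows "disc_radius (ball c r) = r"
  unfolding disc_radius_def
  using assms by (intro the_equality) (auto simp: ball_eq_ball_iff ball_eq_cball_iff)

lemma disc_radius_cball:
  assumes "0 < r"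
  shows "disc_radius (cball c r) = r"
  unfolding disc_radius_def
  using assms by (intro the_equality) (auto simp: cball_eq_ball_iff cball_eq_cball_iff)

(* The collection of open discs is a set, so there is no repetition; "countable" includes finite
   and empty collections. *)
type_synonym cheese = "complex set \<times> complex set set"

definition swiss_cheese :: "cheese \<Rightarrow> bool" where
  "swiss_cheese C \<longleftrightarrow>
     (case C of (\<Delta>, \<D>) \<Rightarrow> closed_disc \<Delta> \<and> countable \<D> \<and> (\<forall>D\<in>\<D>. open_disc D))"

definition swiss_cheese_set :: "cheese \<Rightarrow> complex set" where
  "swiss_cheese_set C = (case C of (\<Delta>, \<D>) \<Rightarrow> \<Delta> - \<Union>\<D>)"

(* Taken in the extended reals, where the unordered sum of the positive radii always exists
   and is \<infinity> if the radii are not summable (a real-valued infsum would then silently be 0). *)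
definition radius_sum :: "complex set set \<Rightarrow> ereal" where
  "radius_sum \<D> = (\<Sum>\<^sub>\<infinity>D\<in>\<D>. ereal (disc_radius D))"

definition discrepancy :: "cheese \<Rightarrow> ereal" where
  "discrepancy C = (case C of (\<Delta>, \<D>) \<Rightarrow> ereal (disc_radius \<Delta>) - radius_sum \<D>)"

lemma radius_summable:
  assumes "\<And>D. D \<in> \<D> \<Longrightarrow> open_disc D"
  shows "(\<lambda>D. ereal (disc_radius D)) summable_on \<D>"
proof (rule nonneg_summable_on_complete)
  fix D assume "D \<in> \<D>"
  then show "0 \<le> ereal (disc_radius D)"
    using assms[of D] by (auto simp: open_disc_def disc_radius_ball)
qed

definition classical_swiss_cheese :: "cheese \<Rightarrow> bool" where
  "classical_swiss_cheese C \<longleftrightarrow>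
     swiss_cheese C \<and>
     (case C of (\<Delta>, \<D>) \<Rightarrow>
        (\<forall>D\<in>\<D>. \<forall>E\<in>\<D>. D \<noteq> E \<longrightarrow> closure D \<inter> closure E = {}) \<and>
        (\<forall>D\<in>\<D>. closure D \<inter> (UNIV - interior \<Delta>) = {}) \<and>
        radius_sum \<D> < \<infinity>)"

end

theory Submission
  imports Defs
begin

text \<open>
  Two discs of radii \<open>r\<close> and \<open>s\<close> whose closures meet fit into one disc of radius \<open>r + s\<close>, and if
  the closure of a disc of radius \<open>s\<close> meets the complement of the interior of a closed disc of
  larger radius \<open>r\<close>, then some closed disc of radius \<open>r - s\<close> lies in the closed disc and avoids
  the other one. Neither replacement enlarges the Swiss cheese set or lowers the discrepancy.
  When there are infinitely many discs, repeating such replacements need not terminate: in a limit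
  of repaired cheeses, discs that were apart can touch again.

  The remedy is to keep track only of which original discs have been amalgamated. A set of
  original discs is called absorbable if one open disc whose radius is the sum of their radii
  contains all of them; a set that also contains the outer disc \<open>\<Delta>\<close> is absorbable if
  \<open>\<Delta>\<close> contains a closed disc, with radius reduced by the sum of the radii of the other members,
  that avoids them. Singletons are absorbable. The union of a chain of absorbable
  sets is absorbable by compactness (\<open>absorbable_chain\<close>): the admissible centres form a compact set
  cut out by one closed condition per point to be covered or avoided, and finitely many points
  already concern a single member of the chain. Zorn's lemma (\<open>maximal_partition\<close>) then gives a
  partition of the original discs together with \<open>\<Delta>\<close> into absorbable blocks, no two of which have
  an absorbable union.

  Replace each block by its absorbing disc. If two of the new closures met, or one left the
  interior of the new outer disc, the two geometric facts would merge two blocks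
  (\<open>absorbable_merge_discs\<close>, \<open>absorbable_merge_outer\<close>), against maximality; so the new cheese is
  classical. Since every radius is fixed by its block and the blocks partition the original
  discs, the discrepancy is exactly preserved.
\<close>

section \<open>Maximal partitions\<close>

text \<open>
  Zorn's lemma is applied to equivalence relations ordered by inclusion rather than to partitions
  ordered by refinement: the supremum of a chain is then a plain union, and the class of a point
  is the union of a chain of its earlier classes.
\<close>

lemma maximal_partition:
  assumes singleton: "\<And>x. x \<in> A \<Longrightarrow> P {x}"
    and chain: "\<And>K. K \<noteq> {} \<Longrightarrow> subset.chain (Pow A) K \<Longrightarrow> (\<And>S. S \<in> K \<Longrightarrow> P S) \<Longrightarrow> P (\<Union>K)"
  shows "\<exists>Q. partition_on A Q \<and> (\<forall>S\<in>Q. P S) \<and>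
           (\<forall>S\<in>Q. \<forall>T\<in>Q. S \<noteq> T \<longrightarrow> \<not> P (S \<union> T))"
proof -
  define \<A> where "\<A> = {r. equiv A r \<and> (\<forall>x\<in>A. P (r `` {x}))}"
  have "\<exists>M\<in>\<A>. \<forall>X\<in>\<A>. M \<subseteq> X \<longrightarrow> X = M"
  proof (rule subset_Zorn_nonempty)
    have "Id_on A \<in> \<A>"
      using singleton
      by (auto simp: \<A>_def equiv_def refl_on_def sym_def trans_def Image_singleton Id_on_iff)
    then show "\<A> \<noteq> {}" by blast
  next
    fix \<C> assume ne: "\<C> \<noteq> {}" and ch: "subset.chain \<A> \<C>"
    have sub: "\<And>r. r \<in> \<C> \<Longrightarrow> equiv A r \<and> (\<forall>x\<in>A. P (r `` {x}))"
      and tot: "\<And>r s. r \<in> \<C> \<Longrightarrow> s \<in> \<C> \<Longrightarrow> r \<subseteq> s \<or> s \<subseteq> r"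
      using ch by (auto simp: subset_chain_def \<A>_def)
    have "equiv A (\<Union>\<C>)"
    proof (rule equivI)
      show "\<Union>\<C> \<subseteq> A \<times> A" using sub by (fastforce simp: equiv_def)
      show "refl_on A (\<Union>\<C>)" using sub ne unfolding refl_on_def equiv_def by fast
      show "sym (\<Union>\<C>)" using sub unfolding sym_def equiv_def by fast
      show "trans (\<Union>\<C>)"
      proof (rule transI)
        fix x y z assume "(x, y) \<in> \<Union>\<C>" "(y, z) \<in> \<Union>\<C>"
        then obtain r s where rs: "r \<in> \<C>" "s \<in> \<C>" "(x, y) \<in> r" "(y, z) \<in> s" by blast
        then obtain t where "t \<in> \<C>" "(x, y) \<in> t" "(y, z) \<in> t" using tot[of r s] by blast
        then show "(x, z) \<in> \<Union>\<C>" using sub[of t] by (auto simp: equiv_def dest: transD)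
      qed
    qed
    moreover have "P (\<Union>\<C> `` {x})" if "x \<in> A" for x
    proof -
      have "P (\<Union>((\<lambda>r. r `` {x}) ` \<C>))"
      proof (rule chain)
        show "subset.chain (Pow A) ((\<lambda>r. r `` {x}) ` \<C>)"
          unfolding subset_chain_def
        proof (intro conjI ballI)
          show "(\<lambda>r. r `` {x}) ` \<C> \<subseteq> Pow A" using sub by (fastforce simp: equiv_def)
          fix S T assume "S \<in> (\<lambda>r. r `` {x}) ` \<C>" "T \<in> (\<lambda>r. r `` {x}) ` \<C>"
          then show "S \<subseteq> T \<or> T \<subseteq> S" using tot by blast
        qed
      qed (use ne sub that in auto)
      moreover have "\<Union>((\<lambda>r. r `` {x}) ` \<C>) = \<Union>\<C> `` {x}" by blast
      ultimately show ?thesis by simp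
    qed
    ultimately show "\<Union>\<C> \<in> \<A>" by (simp add: \<A>_def)
  qed
  then obtain M where M: "equiv A M" "\<And>x. x \<in> A \<Longrightarrow> P (M `` {x})"
    and max: "\<And>r. r \<in> \<A> \<Longrightarrow> M \<subseteq> r \<Longrightarrow> r = M"
    by (auto simp: \<A>_def)
  show ?thesis
  proof (intro exI[of _ "A // M"] conjI ballI impI)
    show "partition_on A (A // M)" using M(1) by (rule partition_on_quotient)
    show "P S" if "S \<in> A // M" for S using that M(2) by (auto simp: quotient_def)
    show "\<not> P (S \<union> T)" if S: "S \<in> A // M" and T: "T \<in> A // M" and "S \<noteq> T" for S T
    proof
      assume PU: "P (S \<union> T)"
      define U where "U = S \<union> T"
      have "U \<subseteq> A" using in_quotient_imp_subset[OF M(1)] S T by (auto simp: U_def)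
      have closed: "y \<in> U" if "x \<in> U" "(x, y) \<in> M" for x y
        using that in_quotient_imp_closed[OF M(1) S] in_quotient_imp_closed[OF M(1) T]
        by (auto simp: U_def)
      have symM: "(y, x) \<in> M" if "(x, y) \<in> M" for x y
        using M(1) that by (auto simp: equiv_def dest: symD)
      \<comment> \<open>As \<open>U\<close> is a union of classes, this relation fuses \<open>S\<close> and \<open>T\<close> and changes no other class.\<close>
      let ?r = "M \<union> U \<times> U"
      have "equiv A ?r"
      proof (rule equivI)
        show "?r \<subseteq> A \<times> A" using M(1) \<open>U \<subseteq> A\<close> by (auto simp: equiv_def)
        show "refl_on A ?r" using M(1) by (auto simp: equiv_def refl_on_def)
        show "sym ?r" using symM by (auto simp: sym_def)
        have "trans M" using M(1) by (auto simp: equiv_def)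
        then show "trans ?r" using closed symM unfolding trans_def by blast
      qed
      moreover have "P (?r `` {x})" if "x \<in> A" for x
      proof (cases "x \<in> U")
        case True
        then have "?r `` {x} = U" using closed by blast
        then show ?thesis using PU by (simp add: U_def)
      next
        case False
        then have "?r `` {x} = M `` {x}" by blast
        then show ?thesis using M(2) that by simp
      qed
      ultimately have "?r = M" using max[of ?r] by (auto simp: \<A>_def)
      then have "U \<times> U \<subseteq> M" by blast
      moreover obtain x y where "x \<in> S" "y \<in> T"
        using in_quotient_imp_non_empty[OF M(1)] S T by blast
      ultimately have "(x, y) \<in> M" by (auto simp: U_def)
      then show False
        using quotient_eqI[OF M(1) S T \<open>x \<in> S\<close> \<open>y \<in> T\<close>] \<open>S \<noteq> T\<close> by simp
    qed
  qed
qed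

lemma countable_partition:
  assumes "disjoint Q" "{} \<notin> Q" "countable (\<Union>Q)"
  shows "countable Q"
proof -
  have "\<forall>S\<in>Q. \<exists>x. x \<in> S" using assms(2) by (metis all_not_in_conv)
  then obtain f where f: "\<And>S. S \<in> Q \<Longrightarrow> f S \<in> S" by metis
  have "inj_on f Q"
    using assms(1) f unfolding inj_on_def disjoint_def by (metis disjoint_iff)
  moreover have "countable (f ` Q)"
    using f by (intro countable_subset[OF _ assms(3)]) auto
  ultimately show ?thesis by (rule countable_image_inj_on[rotated])
qed

section \<open>Discs in the plane\<close>

text \<open>
  A centre \<open>c\<close> serves a point \<open>w\<close> of \<open>U\<close> when it lies in the compact set \<open>cball w r\<close>, so this is the
  finite intersection property of such sets.
\<close>

lemma enclosing_cball_if_finite: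
  fixes U :: "'a::heine_borel set"
  assumes "\<And>F. finite F \<Longrightarrow> F \<subseteq> U \<Longrightarrow> \<exists>c. F \<subseteq> cball c r"
  shows "\<exists>c. U \<subseteq> cball c r"
proof (cases "U = {}")
  case False
  then obtain z where z: "z \<in> U" by blast
  have "cball z r \<inter> (\<Inter>w\<in>U. cball w r) \<noteq> {}"
  proof (rule compact_imp_fip_image)
    fix F assume "finite F" "F \<subseteq> U"
    then obtain c where "insert z F \<subseteq> cball c r" using assms[of "insert z F"] z by auto
    then have "c \<in> cball z r \<inter> (\<Inter>w\<in>F. cball w r)" by (auto simp: dist_commute)
    then show "cball z r \<inter> (\<Inter>w\<in>F. cball w r) \<noteq> {}" by blast
  qed auto
  then obtain c where "\<forall>w\<in>U. c \<in> cball w r" by blast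
  then have "U \<subseteq> cball c r" by (auto simp: dist_commute)
  then show ?thesis by blast
qed auto

text \<open>
  The same argument for avoidance. The avoiding ball has to be open here: it is then a closed
  condition on the centre to keep a given point out.
\<close>

lemma avoiding_ball_if_finite:
  fixes U :: "'a::metric_space set"
  assumes "compact X"
    and "\<And>F. finite F \<Longrightarrow> F \<subseteq> U \<Longrightarrow> \<exists>c\<in>X. F \<inter> ball c r = {}"
  shows "\<exists>c\<in>X. U \<inter> ball c r = {}"
proof -
  have "X \<inter> (\<Inter>w\<in>U. - ball w r) \<noteq> {}"
  proof (rule compact_imp_fip_image[OF \<open>compact X\<close>])
    fix F assume "finite F" "F \<subseteq> U"
    then obtain c where c: "c \<in> X" "F \<inter> ball c r = {}" using assms(2) by blast
    have "c \<in> - ball w r" if "w \<in> F" for w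
      using c(2) that by (auto simp: dist_commute)
    then show "X \<inter> (\<Inter>w\<in>F. - ball w r) \<noteq> {}" using c(1) by blast
  qed (simp add: closed_Compl)
  then obtain c where "c \<in> X" "\<forall>w\<in>U. c \<notin> ball w r" by blast
  then show ?thesis by (intro bexI[of _ c]) (auto simp: dist_commute)
qed

text \<open>
  The centre is the average of \<open>c\<close> and \<open>d\<close> with weights proportional to \<open>r\<close> and \<open>s\<close>; as
  \<open>dist c d \<le> r + s\<close>, it is within \<open>s\<close> of \<open>c\<close> and within \<open>r\<close> of \<open>d\<close>.
\<close>

lemma ball_enclosing_two_touching_balls:
  fixes c d :: "'a::real_normed_vector"
  assumes "0 < r" "0 < s" and "cball c r \<inter> cball d s \<noteq> {}"
  obtains e where "ball c r \<union> ball d s \<subseteq> ball e (r + s)"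
proof -
  obtain z where "dist c z \<le> r" "dist d z \<le> s" using assms(3) by auto
  then have cd: "dist c d \<le> r + s" using dist_triangle2[of c d z] by linarith
  define e where "e = c + (s / (r + s)) *\<^sub>R (d - c)"
  have "e - c = (s / (r + s)) *\<^sub>R (d - c)" by (simp add: e_def)
  then have "dist e c = s / (r + s) * dist c d"
    using assms by (simp add: dist_norm norm_minus_commute)
  also have "\<dots> \<le> s / (r + s) * (r + s)"
    using assms cd by (intro mult_left_mono) auto
  finally have ec: "dist e c \<le> s" using assms by simp
  have "d - e = (1 - s / (r + s)) *\<^sub>R (d - c)" by (simp add: e_def algebra_simps)
  also have "1 - s / (r + s) = r / (r + s)" using assms by (simp add: field_simps)
  finally have "d - e = (r / (r + s)) *\<^sub>R (d - c)" .
  then have "dist e d = r / (r + s) * dist c d"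
    using assms by (simp add: dist_norm norm_minus_commute[of e] norm_minus_commute[of c])
  also have "\<dots> \<le> r / (r + s) * (r + s)"
    using assms cd by (intro mult_left_mono) auto
  finally have ed: "dist e d \<le> r" using assms by simp
  have "dist e x < r + s" if "dist c x < r" for x
    using that ec dist_triangle[of e x c] by linarith
  moreover have "dist e x < r + s" if "dist d x < s" for x
    using that ed dist_triangle[of e x d] by linarith
  ultimately have "ball c r \<subseteq> ball e (r + s)" "ball d s \<subseteq> ball e (r + s)" by auto
  then show thesis using that by blast
qed

text \<open>
  Shift \<open>c\<close> by \<open>s\<close> straight away from \<open>d\<close>: the shrunken ball stays in \<open>cball c r\<close>, and its centre
  is now at distance \<open>dist c d + s \<ge> r\<close> from \<open>d\<close>. The direction exists because \<open>s < r\<close> excludes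
  a protruding ball concentric with \<open>cball c r\<close>.
\<close>

lemma cball_avoiding_protruding_ball:
  fixes c d :: "'a::real_normed_vector"
  assumes "0 < s" "s < r" and "\<not> cball d s \<subseteq> ball c r"
  obtains e where "cball e (r - s) \<subseteq> cball c r - ball d s"
proof -
  have far: "r \<le> dist c d + s"
  proof (rule ccontr)
    assume "\<not> r \<le> dist c d + s"
    then have "dist c x < r" if "dist d x \<le> s" for x
      using that dist_triangle[of c x d] by linarith
    then show False using assms(3) by auto
  qed
  then have "c \<noteq> d" using assms by auto
  define e where "e = c + (s / dist c d) *\<^sub>R (c - d)"
  have ec: "dist e c = s" using assms \<open>c \<noteq> d\<close> by (simp add: e_def dist_norm)
  have "e - d = (1 + s / dist c d) *\<^sub>R (c - d)" by (simp add: e_def algebra_simps)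
  then have "dist e d = \<bar>1 + s / dist c d\<bar> * dist c d" by (simp add: dist_norm)
  also have "\<dots> = dist c d + s" using assms \<open>c \<noteq> d\<close> by (simp add: field_simps)
  finally have ed: "r \<le> dist e d" using far by simp
  have "dist c x \<le> r" if "dist e x \<le> r - s" for x
    using that ec dist_triangle[of c x e] by (simp add: dist_commute)
  then have "cball e (r - s) \<subseteq> cball c r" by auto
  moreover have "cball e (r - s) \<inter> ball d s = {}"
  proof (rule ccontr)
    assume "cball e (r - s) \<inter> ball d s \<noteq> {}"
    then obtain z where "dist e z \<le> r - s" "dist d z < s" by auto
    then show False using ed dist_triangle2[of e d z] by linarith
  qed
  ultimately show thesis using that by blast
qed

section \<open>Sums of radii\<close>

lemma has_sum_partition:
  fixes f :: "'a \<Rightarrow> real"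
  assumes "disjoint Q" and "f summable_on \<Union>Q"
  shows "((\<lambda>S. infsum f S) has_sum infsum f (\<Union>Q)) Q"
proof -
  have bij: "bij_betw snd (SIGMA S:Q. S) (\<Union>Q)"
    using \<open>disjoint Q\<close> by (fastforce simp: bij_betw_def inj_on_def disjoint_def image_iff)
  have "(f has_sum infsum f (\<Union>Q)) (\<Union>Q)" using assms(2) by (rule has_sum_infsum)
  then have "((\<lambda>p. f (snd p)) has_sum infsum f (\<Union>Q)) (SIGMA S:Q. S)"
    using has_sum_reindex_bij_betw[OF bij] by blast
  then show ?thesis
  proof (rule has_sum_Sigma[OF isUCont_plus])
    fix S assume "S \<in> Q"
    then have "f summable_on S" using summable_on_subset_banach[OF assms(2), of S] by blast
    then show "((\<lambda>y. f (snd (S, y))) has_sum infsum f S) S" by simp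
  qed
qed

lemma disc_radius_pos: "open_disc D \<Longrightarrow> 0 < disc_radius D"
  by (auto simp: open_disc_def disc_radius_ball)

lemma radius_sum_eq_infsum:
  assumes "disc_radius summable_on \<D>"
  shows "radius_sum \<D> = ereal (infsum disc_radius \<D>)"
proof -
  have "infsum (ereal \<circ> disc_radius) \<D> = ereal (infsum disc_radius \<D>)"
    using assms by (intro infsum_comm_additive_general) auto
  then show ?thesis by (simp add: radius_sum_def o_def)
qed

lemma summable_disc_radius:
  assumes discs: "\<And>D. D \<in> \<D> \<Longrightarrow> open_disc D" and fin: "radius_sum \<D> < \<infinity>"
  shows "disc_radius summable_on \<D>"
proof (rule nonneg_bdd_above_summable_on)
  show nonneg: "0 \<le> disc_radius D" if "D \<in> \<D>" for D
    using disc_radius_pos[OF discs[OF that]] by simp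
  have SUP: "radius_sum \<D> = (SUP F\<in>{F. finite F \<and> F \<subseteq> \<D>}. \<Sum>D\<in>F. ereal (disc_radius D))"
    unfolding radius_sum_def by (rule nonneg_infsum_complete) (simp add: nonneg)
  have le: "ereal (sum disc_radius F) \<le> radius_sum \<D>" if "F \<subseteq> \<D>" "finite F" for F
    unfolding SUP using that by (intro SUP_upper2[of F]) auto
  then have "0 \<le> radius_sum \<D>" using le[of "{}"] by (simp add: zero_ereal_def)
  with fin obtain s where "radius_sum \<D> = ereal s" by (cases "radius_sum \<D>") auto
  with le show "bdd_above (sum disc_radius ` {F. F \<subseteq> \<D> \<and> finite F})"
    by (intro bdd_aboveI[of _ s]) auto
qed

section \<open>Absorbable collections of discs\<close>

text \<open>
  The standing data are an outer disc and a collection of open discs with positive discrepancy,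
  expressed in the reals.
\<close>

locale positive_cheese =
  fixes a :: complex and R :: real and \<D> :: "complex set set"
  assumes discs: "D \<in> \<D> \<Longrightarrow> open_disc D"
    and summable: "disc_radius summable_on \<D>"
    and total_less: "infsum disc_radius \<D> < R"
begin

abbreviation \<Delta> :: "complex set" where "\<Delta> \<equiv> cball a R"

abbreviation total :: "complex set set \<Rightarrow> real" where "total \<equiv> infsum disc_radius"

text \<open>
  A block of amalgamated discs may contain the outer disc \<open>\<Delta>\<close>, which serves as its own label: being
  closed, \<open>\<Delta>\<close> is never one of the open discs in \<open>\<D>\<close>. The radius of the absorbing disc is prescribed,
  so that only its centre has to be found in limits.
\<close>

definition absorbable :: "complex set set \<Rightarrow> bool" where
  "absorbable S \<longleftrightarrow>
     (if \<Delta> \<in> S then \<exists>c. cball c (R - total (S - {\<Delta>})) \<subseteq> \<Delta> - \<Union>(S - {\<Delta>})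
      else \<exists>c. \<Union>S \<subseteq> ball c (total S))"

lemma radius_pos: "D \<in> \<D> \<Longrightarrow> 0 < disc_radius D"
  using discs disc_radius_pos by blast

lemma summable_subset: "S \<subseteq> \<D> \<Longrightarrow> disc_radius summable_on S"
  using summable summable_on_subset_banach by blast

lemma total_mono: "S \<subseteq> T \<Longrightarrow> T \<subseteq> \<D> \<Longrightarrow> total S \<le> total T"
  by (rule infsum_mono2) (use radius_pos in \<open>fastforce intro: summable_subset\<close>)+

lemma total_less_R: "S \<subseteq> \<D> \<Longrightarrow> total S < R"
  using total_mono[of S \<D>] total_less by simp

lemma total_pos: "S \<subseteq> \<D> \<Longrightarrow> S \<noteq> {} \<Longrightarrow> 0 < total S"
proof -
  assume "S \<subseteq> \<D>" "S \<noteq> {}"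
  then obtain D where "D \<in> S" by blast
  with \<open>S \<subseteq> \<D>\<close> total_mono[of "{D}" S] radius_pos[of D] show "0 < total S" by auto
qed

lemma total_Un: "S \<subseteq> \<D> \<Longrightarrow> T \<subseteq> \<D> \<Longrightarrow> S \<inter> T = {} \<Longrightarrow> total (S \<union> T) = total S + total T"
  by (rule infsum_Un_disjoint) (rule summable_subset | assumption)+

lemma R_pos: "0 < R"
  using total_less_R[of "{}"] by simp

lemma Delta_notin: "\<Delta> \<notin> \<D>"
  using discs[of \<Delta>] R_pos by (auto simp: open_disc_def cball_eq_ball_iff)

lemma open_Union_discs: "S \<subseteq> \<D> \<Longrightarrow> open (\<Union>S)"
  using discs by (auto simp: open_disc_def)

lemma absorbable_singleton:
  assumes "D \<in> insert \<Delta> \<D>"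
  shows "absorbable {D}"
proof (cases "D = \<Delta>")
  case True
  then show ?thesis by (auto simp: absorbable_def)
next
  case False
  with assms have "open_disc D" using discs by blast
  then show ?thesis using False by (auto simp: absorbable_def open_disc_def disc_radius_ball)
qed

text \<open>
  Finitely many points of the union lie in the discs of one member of the chain, whose absorbing
  disc has radius at most the total for the union. Compactness gives a closed disc of that total
  radius, which may be replaced by its interior because the covered set is open.
\<close>

lemma absorbable_chain_inner:
  assumes "K \<noteq> {}" "subset.chain (Pow \<D>) K" "\<And>S. S \<in> K \<Longrightarrow> absorbable S"
  shows "absorbable (\<Union>K)"
proof -
  have sub: "S \<subseteq> \<D>" if "S \<in> K" for S using assms(2) that by (auto simp: subset_chain_def)
  then have subU: "\<Union>K \<subseteq> \<D>" by blast
  have chain: "subset.chain UNIV (Union ` K)"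
    unfolding subset_chain_def
  proof (intro conjI ballI)
    fix X Y assume "X \<in> Union ` K" "Y \<in> Union ` K"
    then obtain S T where "S \<in> K" "T \<in> K" "X = \<Union>S" "Y = \<Union>T" by blast
    moreover from this have "S \<subseteq> T \<or> T \<subseteq> S" using assms(2) by (auto simp: subset_chain_def)
    ultimately show "X \<subseteq> Y \<or> Y \<subseteq> X" by (metis Union_mono)
  qed simp
  have "\<exists>c. \<Union>(\<Union>K) \<subseteq> cball c (total (\<Union>K))"
  proof (rule enclosing_cball_if_finite)
    fix F assume F: "finite F" "F \<subseteq> \<Union>(\<Union>K)"
    then have "F \<subseteq> \<Union>(Union ` K)" by blast
    then obtain X where "X \<in> Union ` K" "F \<subseteq> X"
      by (rule finite_subset_Union_chain[OF F(1) _ _ chain]) (use assms(1) in simp)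
    then obtain S where S: "S \<in> K" "F \<subseteq> \<Union>S" by blast
    then obtain c where "\<Union>S \<subseteq> ball c (total S)"
      using assms(3)[OF S(1)] sub Delta_notin by (auto simp: absorbable_def split: if_splits)
    moreover have "ball c (total S) \<subseteq> cball c (total (\<Union>K))"
      using total_mono[OF _ subU, of S] S(1) by fastforce
    ultimately show "\<exists>c. F \<subseteq> cball c (total (\<Union>K))" using S(2) by blast
  qed
  then obtain c where "\<Union>(\<Union>K) \<subseteq> cball c (total (\<Union>K))" by blast
  with open_Union_discs[OF subU] have "\<Union>(\<Union>K) \<subseteq> ball c (total (\<Union>K))"
    using interior_maximal[of "\<Union>(\<Union>K)"] by (metis interior_cball)
  then show ?thesis using subU Delta_notin by (auto simp: absorbable_def)
qed

text \<open>
  The dual argument: the points to be avoided are those outside \<open>\<Delta>\<close> and those of the discs in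
  the chain. They form an open set, so an open disc that avoids them has a closure that does too.
  The limiting radius is positive because the discrepancy is.
\<close>

lemma absorbable_chain_outer:
  assumes "K \<noteq> {}" "subset.chain (Pow (insert \<Delta> \<D>)) K" "\<And>S. S \<in> K \<Longrightarrow> absorbable S"
    and Delta: "\<And>S. S \<in> K \<Longrightarrow> \<Delta> \<in> S"
  shows "absorbable (\<Union>K)"
proof -
  define rest where "rest S = S - {\<Delta>}" for S
  define forbidden where "forbidden S = - \<Delta> \<union> \<Union>(rest S)" for S
  have tot: "S \<subseteq> T \<or> T \<subseteq> S" if "S \<in> K" "T \<in> K" for S T
    using assms(2) that by (auto simp: subset_chain_def)
  have subU: "rest (\<Union>K) \<subseteq> \<D>"
    using assms(2) by (auto simp: subset_chain_def rest_def)
  have forbidden_Union: "\<Union>(forbidden ` K) = forbidden (\<Union>K)"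
    using assms(1) by (auto simp: forbidden_def rest_def)
  have chain: "subset.chain UNIV (forbidden ` K)"
    unfolding subset_chain_def
  proof (intro conjI ballI)
    fix X Y assume "X \<in> forbidden ` K" "Y \<in> forbidden ` K"
    then obtain S T where "S \<in> K" "T \<in> K" "X = forbidden S" "Y = forbidden T" by blast
    moreover from this have "S \<subseteq> T \<or> T \<subseteq> S" using tot by blast
    moreover have "forbidden S \<subseteq> forbidden T" if "S \<subseteq> T" for S T
      using that by (auto simp: forbidden_def rest_def)
    ultimately show "X \<subseteq> Y \<or> Y \<subseteq> X" by blast
  qed simp
  define \<rho> where "\<rho> = R - total (rest (\<Union>K))"
  have "0 < \<rho>" using total_less_R[OF subU] by (simp add: \<rho>_def)
  have "\<exists>c\<in>\<Delta>. forbidden (\<Union>K) \<inter> ball c \<rho> = {}"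
  proof (rule avoiding_ball_if_finite)
    fix F assume F: "finite F" "F \<subseteq> forbidden (\<Union>K)"
    then have "F \<subseteq> \<Union>(forbidden ` K)" using forbidden_Union by simp
    then obtain X where "X \<in> forbidden ` K" "F \<subseteq> X"
      by (rule finite_subset_Union_chain[OF F(1) _ _ chain]) (use assms(1) in simp)
    then obtain S where S: "S \<in> K" "F \<subseteq> forbidden S" by blast
    then obtain c where c: "cball c (R - total (rest S)) \<subseteq> \<Delta> - \<Union>(rest S)"
      using assms(3)[OF S(1)] Delta by (auto simp: absorbable_def rest_def)
    have "\<rho> \<le> R - total (rest S)"
      using total_mono[OF _ subU, of "rest S"] S(1) by (auto simp: \<rho>_def rest_def)
    then have sub: "cball c \<rho> \<subseteq> \<Delta> - \<Union>(rest S)"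
      using c by (meson cball_subset_cball_iff order_trans subset_cball)
    moreover have "c \<in> cball c \<rho>" using \<open>0 < \<rho>\<close> by simp
    ultimately have "c \<in> \<Delta>" by blast
    moreover have "F \<inter> ball c \<rho> = {}"
      using sub S(2) ball_subset_cball[of c \<rho>] unfolding forbidden_def by blast
    ultimately show "\<exists>c\<in>\<Delta>. F \<inter> ball c \<rho> = {}" by blast
  qed simp
  then obtain c where "forbidden (\<Union>K) \<inter> ball c \<rho> = {}" by blast
  moreover have "open (forbidden (\<Union>K))"
    unfolding forbidden_def by (intro open_Un open_Union_discs subU open_Compl closed_cball)
  ultimately have "forbidden (\<Union>K) \<inter> closure (ball c \<rho>) = {}"
    by (simp add: open_Int_closure_eq_empty)
  then have "cball c \<rho> \<subseteq> \<Delta> - \<Union>(rest (\<Union>K))"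
    using \<open>0 < \<rho>\<close> by (auto simp: forbidden_def)
  then show ?thesis
    using assms(1) Delta by (auto simp: absorbable_def rest_def \<rho>_def)
qed

lemma absorbable_chain:
  assumes "K \<noteq> {}" "subset.chain (Pow (insert \<Delta> \<D>)) K" "\<And>S. S \<in> K \<Longrightarrow> absorbable S"
  shows "absorbable (\<Union>K)"
proof (cases "\<Delta> \<in> \<Union>K")
  case False
  then have "subset.chain (Pow \<D>) K" using assms(2) by (auto simp: subset_chain_def)
  then show ?thesis using absorbable_chain_inner assms by blast
next
  case True
  then obtain S where S: "S \<in> K" "\<Delta> \<in> S" by blast
  \<comment> \<open>Members without \<open>\<Delta>\<close> lie below a member that contains it, so they can be dropped.\<close>
  let ?K = "{T \<in> K. \<Delta> \<in> T}"
  have "T \<subseteq> S \<or> \<Delta> \<in> T" if "T \<in> K" for T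
    using assms(2) S that unfolding subset_chain_def by blast
  then have "\<Union>K = \<Union>?K" using S by blast
  moreover have "absorbable (\<Union>?K)"
    using assms S by (intro absorbable_chain_outer) (auto simp: subset_chain_def)
  ultimately show ?thesis by simp
qed

lemma absorbable_merge_discs:
  assumes "S \<subseteq> \<D>" "T \<subseteq> \<D>" "S \<noteq> {}" "T \<noteq> {}" "S \<inter> T = {}"
    and "\<Union>S \<subseteq> ball c (total S)" "\<Union>T \<subseteq> ball d (total T)"
    and "cball c (total S) \<inter> cball d (total T) \<noteq> {}"
  shows "absorbable (S \<union> T)"
proof -
  obtain e where "ball c (total S) \<union> ball d (total T) \<subseteq> ball e (total S + total T)"
    using ball_enclosing_two_touching_balls[OF total_pos total_pos assms(8)] assms by blast
  then have "\<Union>(S \<union> T) \<subseteq> ball e (total (S \<union> T))"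
    using assms total_Un[of S T] by auto
  then show ?thesis using assms Delta_notin by (auto simp: absorbable_def)
qed

lemma absorbable_merge_outer:
  assumes "S \<subseteq> \<D>" "T \<subseteq> \<D>" "S \<noteq> {}" "S \<inter> T = {}"
    and S: "\<Union>S \<subseteq> ball d (total S)" and T: "cball c (R - total T) \<subseteq> \<Delta> - \<Union>T"
    and "\<not> cball d (total S) \<subseteq> ball c (R - total T)"
  shows "absorbable (S \<union> insert \<Delta> T)"
proof -
  have Un: "total (S \<union> T) = total S + total T" using assms total_Un by blast
  moreover have "total (S \<union> T) < R" using assms total_less_R by simp
  ultimately have "total S < R - total T" by simp
  then obtain e where "cball e (R - total T - total S) \<subseteq> cball c (R - total T) - ball d (total S)"
    using cball_avoiding_protruding_ball[OF total_pos _ assms(7)] assms(1,3) by blast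
  then have "cball e (R - total (S \<union> T)) \<subseteq> \<Delta> - \<Union>(S \<union> T)"
    using S T Un by (fastforce simp: algebra_simps)
  moreover have "S \<union> insert \<Delta> T - {\<Delta>} = S \<union> T" using assms(1,2) Delta_notin by blast
  ultimately show ?thesis unfolding absorbable_def by auto
qed

section \<open>Classicalisation\<close>

text \<open>
  In the proof, \<open>S0\<close> is the block of the outer disc and yields the new outer disc; every other
  block yields one new open disc. Distinct blocks yield distinct discs, so the radii of the set of
  new discs sum to the block totals without loss.
\<close>

lemma classicalisation:
  assumes "countable \<D>"
  shows "\<exists>C'. classical_swiss_cheese C' \<and>
           swiss_cheese_set C' \<subseteq> \<Delta> - \<Union>\<D> \<and>
           discrepancy C' = ereal (R - total \<D>)"
proof -
  have "\<exists>Q. partition_on (insert \<Delta> \<D>) Q \<and> (\<forall>S\<in>Q. absorbable S) \<and>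
      (\<forall>S\<in>Q. \<forall>T\<in>Q. S \<noteq> T \<longrightarrow> \<not> absorbable (S \<union> T))"
    by (rule maximal_partition[OF absorbable_singleton absorbable_chain])
  then obtain Q where Q: "partition_on (insert \<Delta> \<D>) Q" and "\<forall>S\<in>Q. absorbable S"
    and "\<forall>S\<in>Q. \<forall>T\<in>Q. S \<noteq> T \<longrightarrow> \<not> absorbable (S \<union> T)"
    by metis
  then have abs: "\<And>S. S \<in> Q \<Longrightarrow> absorbable S"
    and max: "\<And>S T. S \<in> Q \<Longrightarrow> T \<in> Q \<Longrightarrow> S \<noteq> T \<Longrightarrow> \<not> absorbable (S \<union> T)"
    by simp_all
  have UQ: "\<Union>Q = insert \<Delta> \<D>" and disj: "disjoint Q" and ne: "{} \<notin> Q"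
    using Q by (auto simp: partition_on_def)
  obtain S0 where S0: "S0 \<in> Q" "\<Delta> \<in> S0" using UQ by blast
  define T0 where "T0 = S0 - {\<Delta>}"
  define P where "P = Q - {S0}"
  have "T0 \<subseteq> \<D>" using S0 UQ by (auto simp: T0_def)
  have P_Q: "S \<in> Q" "S \<noteq> S0" if "S \<in> P" for S using that by (auto simp: P_def)
  have P_disj: "S \<inter> T = {}" if "S \<in> Q" "T \<in> Q" "S \<noteq> T" for S T
    using disj that by (auto simp: disjoint_def)
  have P_Delta: "\<Delta> \<notin> S" if "S \<in> P" for S using P_disj[of S S0] P_Q[OF that] S0 by blast
  have P_sub: "S \<subseteq> \<D>" if "S \<in> P" for S
    using Union_upper[OF P_Q(1)[OF that]] P_Delta[OF that] unfolding UQ by (simp add: subset_insert)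
  have P_ne: "S \<noteq> {}" if "S \<in> P" for S using P_Q(1)[OF that] ne by metis
  have P_pos: "0 < total S" if "S \<in> P" for S using total_pos[OF P_sub[OF that] P_ne[OF that]] .
  have UP: "\<Union>P = \<D> - T0"
  proof -
    have "\<Union>P = \<Union>Q - S0" using P_disj[OF _ S0(1)] unfolding P_def by blast
    then show ?thesis using UQ Delta_notin S0(2) by (auto simp: T0_def)
  qed
  obtain a' where a': "cball a' (R - total T0) \<subseteq> \<Delta> - \<Union>T0"
    using abs[OF S0(1)] S0(2) by (auto simp: absorbable_def T0_def)
  define R' where "R' = R - total T0"
  have "0 < R'" using total_less_R[OF \<open>T0 \<subseteq> \<D>\<close>] by (simp add: R'_def)
  have "\<forall>S\<in>P. \<exists>c. \<Union>S \<subseteq> ball c (total S)"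
    using abs P_Q P_Delta by (auto simp: absorbable_def split: if_splits)
  then obtain c where c: "\<And>S. S \<in> P \<Longrightarrow> \<Union>S \<subseteq> ball (c S) (total S)" by metis
  define B where "B S = ball (c S) (total S)" for S
  have closure_B: "closure (B S) = cball (c S) (total S)" if "S \<in> P" for S
    using P_pos[OF that] by (simp add: B_def)
  have apart: "closure (B S) \<inter> closure (B T) = {}" if "S \<in> P" "T \<in> P" "S \<noteq> T" for S T
  proof (rule ccontr)
    assume "closure (B S) \<inter> closure (B T) \<noteq> {}"
    then have "absorbable (S \<union> T)"
      using that closure_B
      by (intro absorbable_merge_discs[OF P_sub P_sub P_ne P_ne P_disj[OF P_Q(1) P_Q(1)] c c]) auto
    then show False using max[OF P_Q(1) P_Q(1)] that by simp
  qed
  have inside: "closure (B S) \<subseteq> ball a' R'" if "S \<in> P" for S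
  proof (rule ccontr)
    assume "\<not> closure (B S) \<subseteq> ball a' R'"
    then have "\<not> cball (c S) (total S) \<subseteq> ball a' (R - total T0)"
      using closure_B[OF that] by (simp add: R'_def)
    moreover have "S \<inter> T0 = {}" using UP that by blast
    ultimately have "absorbable (S \<union> insert \<Delta> T0)"
      using absorbable_merge_outer[OF P_sub[OF that] \<open>T0 \<subseteq> \<D>\<close> P_ne[OF that] _ c[OF that] a'] by simp
    moreover have "insert \<Delta> T0 = S0" using S0 by (auto simp: T0_def)
    ultimately show False using max[OF P_Q(1)[OF that] S0(1) P_Q(2)[OF that]] by simp
  qed
  have inj: "inj_on B P"
  proof (rule inj_onI, rule ccontr)
    fix S T assume ST: "S \<in> P" "T \<in> P" "B S = B T" "S \<noteq> T"
    then have "closure (B S) = {}" using apart[of S T] by simp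
    then show False using closure_B[OF ST(1)] P_pos[OF ST(1)] by simp
  qed
  have "((\<lambda>S. total S) has_sum total (\<Union>P)) P"
    using disj summable_subset[of "\<Union>P"] UP
    by (intro has_sum_partition) (auto simp: P_def disjoint_def)
  moreover have "((\<lambda>S. total S) has_sum total (\<Union>P)) P \<longleftrightarrow>
      (disc_radius \<circ> B has_sum total (\<Union>P)) P"
    by (rule has_sum_cong) (simp add: B_def P_pos disc_radius_ball)
  ultimately have has_sum: "(disc_radius has_sum total (\<Union>P)) (B ` P)"
    using inj by (simp add: has_sum_reindex)
  then have "radius_sum (B ` P) = ereal (total (\<D> - T0))"
    using radius_sum_eq_infsum[of "B ` P"] infsumI[OF has_sum] UP
    by (auto simp: summable_on_def)
  moreover have "total \<D> = total T0 + total (\<D> - T0)"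
    using total_Un[of T0 "\<D> - T0"] \<open>T0 \<subseteq> \<D>\<close> by (simp add: Un_absorb1)
  ultimately have disc: "discrepancy (cball a' R', B ` P) = ereal (R - total \<D>)"
    and fin: "radius_sum (B ` P) < \<infinity>"
    using \<open>0 < R'\<close> by (auto simp: discrepancy_def disc_radius_cball R'_def)
  have "countable Q"
    using countable_partition[OF disj ne] UQ assms by simp
  then have "swiss_cheese (cball a' R', B ` P)"
    using \<open>0 < R'\<close> P_pos
    by (auto simp: swiss_cheese_def closed_disc_def open_disc_def B_def P_def)
  then have "classical_swiss_cheese (cball a' R', B ` P)"
    using apart inside fin by (fastforce simp: classical_swiss_cheese_def)
  moreover have "swiss_cheese_set (cball a' R', B ` P) \<subseteq> \<Delta> - \<Union>\<D>"
  proof -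
    have "\<Union>\<D> \<subseteq> \<Union>T0 \<union> \<Union>(B ` P)"
    proof
      fix z assume "z \<in> \<Union>\<D>"
      then obtain D where D: "D \<in> \<D>" "z \<in> D" by blast
      show "z \<in> \<Union>T0 \<union> \<Union>(B ` P)"
      proof (cases "D \<in> T0")
        case False
        then obtain S where "S \<in> P" "D \<in> S" using D(1) UP by blast
        then show ?thesis using c[of S] D(2) unfolding B_def by blast
      qed (use D in blast)
    qed
    then show ?thesis using a' by (auto simp: swiss_cheese_set_def R'_def)
  qed
  ultimately show ?thesis using disc by blast
qed

end

theorem theorem2p1:
  fixes C :: cheese
  assumes "swiss_cheese C"
    and "discrepancy C > 0"
  shows "\<exists>C'. classical_swiss_cheese C' \<and>
           swiss_cheese_set C' \<subseteq> swiss_cheese_set C \<and>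
           discrepancy C' \<ge> discrepancy C"
proof -
  obtain a R \<D> where C: "C = (cball a R, \<D>)" and "0 < R" and "countable \<D>"
    and discs: "\<And>D. D \<in> \<D> \<Longrightarrow> open_disc D"
    using assms(1) by (cases C) (auto simp: swiss_cheese_def closed_disc_def)
  have disc: "discrepancy C = ereal R - radius_sum \<D>"
    using \<open>0 < R\<close> by (simp add: C discrepancy_def disc_radius_cball)
  have "radius_sum \<D> < \<infinity>" using assms(2) unfolding disc by (cases "radius_sum \<D>") auto
  then have summable: "disc_radius summable_on \<D>" using summable_disc_radius discs by blast
  then have disc_eq: "discrepancy C = ereal (R - infsum disc_radius \<D>)"
    by (simp add: disc radius_sum_eq_infsum)
  then interpret positive_cheese a R \<D>
    using assms(2) discs summable by unfold_locales auto
  show ?thesis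
    using classicalisation[OF \<open>countable \<D>\<close>] unfolding disc_eq
    by (metis C swiss_cheese_set_def case_prod_conv order_refl)
qed

end
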